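(* Let $T=(V,E)$ be a finite tree. For every $p\in[1,\infty]$, among all hub labelings of $T$ that minimize the $\ell_p$-cost, there is one that is hierarchical.
   Context: For a tree $T=(V,E)$ and vertices $u,v\in V$, let $P_{uv}$ denote the set of vertices on the unique path between $u$ and $v$ (so $P_{uu}=\{u\}$). A hub labeling of $T$ is a collection of sets $H=\{H_u\}_{u\in V}$, $H_u\subseteq V$, such that for every (unordered) pair $u,v\in V$, including $u=v$, we have $H_u\cap H_v\cap P_{uv}\neq\varnothing$. For $p\in[1,\infty)$ the $\ell_p$-cost of $H$ is $\left(\sum_{u\in V}|H_u|^p\right)^{1/p}$, and the $\ell_\infty$-cost is $\max_{u\in V}|H_u|$; the problem HL$_p$ asks for a hub labeling of minimum $\ell_p$-cost. Write $u\preceq v$ if $u\in H_v$. The hub labeling $H$ is hierarchical if the relation $\preceq$ is a partial order on $V$. *)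

theory Defs
  imports "HOL-Analysis.Analysis"
begin

text \<open>Finite simple graphs are given by a vertex set \<open>V\<close> and a set \<open>E\<close> of two-element
  subsets of \<open>V\<close>; walks are represented by their vertex lists.\<close>

definition simple_graph :: "'a set \<Rightarrow> 'a set set \<Rightarrow> bool" where
  "simple_graph V E \<longleftrightarrow> finite V \<and> E \<subseteq> {{u, v} | u v. u \<in> V \<and> v \<in> V \<and> u \<noteq> v}"

definition path_between :: "'a set \<Rightarrow> 'a set set \<Rightarrow> 'a \<Rightarrow> 'a list \<Rightarrow> 'a \<Rightarrow> bool" where
  "path_between V E u xs v \<longleftrightarrow>
     xs \<noteq> [] \<and> set xs \<subseteq> V \<and> distinct xs \<and> successively (\<lambda>x y. {x, y} \<in> E) xs \<and>
     hd xs = u \<and> last xs = v"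

text \<open>A cycle lists every vertex once; the closing edge joins the last vertex to the first.\<close>

definition graph_cycle :: "'a set \<Rightarrow> 'a set set \<Rightarrow> 'a list \<Rightarrow> bool" where
  "graph_cycle V E xs \<longleftrightarrow>
     3 \<le> length xs \<and> set xs \<subseteq> V \<and> distinct xs \<and> successively (\<lambda>x y. {x, y} \<in> E) xs \<and>
     {last xs, hd xs} \<in> E"

definition connected_graph :: "'a set \<Rightarrow> 'a set set \<Rightarrow> bool" where
  "connected_graph V E \<longleftrightarrow> V \<noteq> {} \<and> (\<forall>u\<in>V. \<forall>v\<in>V. \<exists>xs. path_between V E u xs v)"

definition finite_tree :: "'a set \<Rightarrow> 'a set set \<Rightarrow> bool" where
  "finite_tree V E \<longleftrightarrow>
     simple_graph V E \<and> connected_graph V E \<and> (\<nexists>xs. graph_cycle V E xs)"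

definition path_verts :: "'a set \<Rightarrow> 'a set set \<Rightarrow> 'a \<Rightarrow> 'a \<Rightarrow> 'a set" where
  "path_verts V E u v = set (THE xs. path_between V E u xs v)"

text \<open>The description in \<open>path_verts\<close> is well defined on trees.\<close>

lemma path_between_unique:
  assumes "\<nexists>cs. graph_cycle V E cs" "path_between V E u xs v" "path_between V E u ys v"
  shows "xs = ys"
  using assms(2,3)
proof (induction xs arbitrary: u ys)
  case Nil
  then show ?case by (simp add: path_between_def)
next
  case (Cons x xs)
  then have x: "x = u" by (simp add: path_between_def)
  obtain ys' where ys: "ys = u # ys'"
    using Cons.prems(2) by (cases ys) (auto simp: path_between_def)
  show ?case
  proof (cases "xs = [] \<or> ys' = []")
    case True
    then have "u = v" using Cons.prems x ys by (auto simp: path_between_def)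
    then show ?thesis using Cons.prems x ys
      by (auto simp: path_between_def split: if_splits)
  next
    case False
    then have ne: "xs \<noteq> []" "ys' \<noteq> []" by auto
    have px: "path_between V E (hd xs) xs v" and ux: "u \<notin> set xs" "{u, hd xs} \<in> E" "u \<in> V"
      using Cons.prems(1) x ne by (auto simp: path_between_def successively_Cons)
    have py: "path_between V E (hd ys') ys' v" and uy: "u \<notin> set ys'" "{u, hd ys'} \<in> E"
      using Cons.prems(2) ys ne by (auto simp: path_between_def successively_Cons)
    show ?thesis
    proof (cases "hd xs = hd ys'")
      case True
      then show ?thesis using Cons.IH[of "hd xs" ys'] px py x ys by simp
    next
      case neq: False
      have "\<exists>z\<in>set xs. z \<in> set ys'"
        using px py ne by (metis last_in_set path_between_def)
      then obtain p z r where xs: "xs = p @ z # r" and z: "z \<in> set ys'"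
        and p: "\<forall>w\<in>set p. w \<notin> set ys'"
        by (rule split_list_first_propE)
      obtain q s where ys': "ys' = q @ z # s"
        using z by (meson split_list)
      let ?c = "(u # p @ [z]) @ rev q"
      have sx: "successively (\<lambda>x y. {x, y} \<in> E) (u # p @ [z])"
        using px ux xs by (cases p) (auto simp: path_between_def successively_Cons successively_append_iff hd_append split: if_splits)
      have sy: "successively (\<lambda>x y. {x, y} \<in> E) (q @ [z])"
        using py ys' by (auto simp: path_between_def successively_append_iff)
      then have sy': "successively (\<lambda>x y. {x, y} \<in> E) (rev q)"
        "q \<noteq> [] \<Longrightarrow> {z, last q} \<in> E"
        by (auto simp: successively_append_iff insert_commute)
      have "successively (\<lambda>x y. {x, y} \<in> E) ?c"
        using sx sy' unfolding successively_append_iff[of _ "u # p @ [z]"]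
        by (auto simp: hd_rev)
      moreover have "distinct ?c"
        using px py ux uy xs ys' p by (auto simp: path_between_def)
      moreover have "set ?c \<subseteq> V"
        using px py ux xs ys' by (auto simp: path_between_def)
      moreover have "{last ?c, hd ?c} \<in> E"
        using uy ys' by (cases q) (auto simp: insert_commute)
      moreover have "3 \<le> length ?c"
        using neq xs ys' by (cases p; cases q) auto
      ultimately show ?thesis using assms(1) unfolding graph_cycle_def by blast
    qed
  qed
qed

lemma finite_tree_unique_path:
  assumes "finite_tree V E" "u \<in> V" "v \<in> V"
  shows "\<exists>!xs. path_between V E u xs v"
  using assms path_between_unique[of V E u _ v]
  unfolding finite_tree_def connected_graph_def by blast

text \<open>A labeling is a function on vertices of which only the values on \<open>V\<close> matter.\<close>

definition hub_labeling :: "'a set \<Rightarrow> 'a set set \<Rightarrow> ('a \<Rightarrow> 'a set) \<Rightarrow> bool" where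
  "hub_labeling V E H \<longleftrightarrow>
     (\<forall>u\<in>V. H u \<subseteq> V) \<and> (\<forall>u\<in>V. \<forall>v\<in>V. H u \<inter> H v \<inter> path_verts V E u v \<noteq> {})"

definition lp_cost :: "'a set \<Rightarrow> ereal \<Rightarrow> ('a \<Rightarrow> 'a set) \<Rightarrow> real" where
  "lp_cost V p H =
     (if p = \<infinity> then real (Max ((\<lambda>u. card (H u)) ` V))
      else (\<Sum>u\<in>V. real (card (H u)) powr real_of_ereal p) powr (1 / real_of_ereal p))"

definition optimal_hub_labeling :: "'a set \<Rightarrow> 'a set set \<Rightarrow> ereal \<Rightarrow> ('a \<Rightarrow> 'a set) \<Rightarrow> bool" where
  "optimal_hub_labeling V E p H \<longleftrightarrow>
     hub_labeling V E H \<and> (\<forall>H'. hub_labeling V E H' \<longrightarrow> lp_cost V p H \<le> lp_cost V p H')"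

definition hierarchical :: "'a set \<Rightarrow> ('a \<Rightarrow> 'a set) \<Rightarrow> bool" where
  "hierarchical V H \<longleftrightarrow> partial_order_on V {(u, v). u \<in> V \<and> v \<in> V \<and> u \<in> H v}"

end

(* From any hub labeling H one obtains a hierarchical one whose hub sets are no larger, vertex by
   vertex.  The subtrees spanned by the sets H u intersect pairwise, so by the Helly property of
   subtrees they share a vertex r.  For u in a component C of T - r, the set H u contains a hub
   outside C, because r lies on the path from u to one of its hubs; so H u can be
   replaced by {r} Un (H u Int C) without becoming larger.  Recursion on the components of T - r
   gives the hierarchy. *)

theory Submission
  imports Defs
begin

section \<open>Order axioms and monotonicity of the cost\<close>

lemma hierarchical_iff:
  "hierarchical S H \<longleftrightarrow>
     (\<forall>u\<in>S. u \<in> H u) \<and>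
     (\<forall>u\<in>S. \<forall>v\<in>S. u \<in> H v \<longrightarrow> v \<in> H u \<longrightarrow> u = v) \<and>
     (\<forall>u\<in>S. \<forall>v\<in>S. \<forall>w\<in>S. u \<in> H v \<longrightarrow> v \<in> H w \<longrightarrow> u \<in> H w)"
  unfolding hierarchical_def partial_order_on_def preorder_on_def refl_on_def antisym_def trans_def
  by blast

lemma lp_cost_mono:
  assumes "finite V" "V \<noteq> {}" "1 \<le> p" "\<And>u. u \<in> V \<Longrightarrow> card (H u) \<le> card (K u)"
  shows "lp_cost V p H \<le> lp_cost V p K"
proof (cases "p = \<infinity>")
  case True
  have "card (H u) \<le> Max ((\<lambda>u. card (K u)) ` V)" if "u \<in> V" for u
    using assms(1,4) that by (meson Max_ge finite_imageI imageI le_trans)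
  then show ?thesis
    using True assms(1,2) by (simp add: lp_cost_def)
next
  case False
  \<comment> \<open>\<open>real_of_ereal\<close> sends both infinities to 0;
    \<open>1 \<le> p\<close> excludes the negative one, so the exponent is genuine.\<close>
  with assms(3) have "1 \<le> real_of_ereal p"
    by (cases p) auto
  then show ?thesis
    using False assms(4)
    by (auto simp: lp_cost_def intro!: powr_mono2 sum_mono sum_nonneg)
qed

lemma lp_cost_cong:
  assumes "\<And>u. u \<in> V \<Longrightarrow> H u = K u"
  shows "lp_cost V p H = lp_cost V p K"
  using assms by (simp add: lp_cost_def cong: image_cong sum.cong)

section \<open>Splitting and joining simple paths\<close>

lemma path_between_rev:
  assumes "path_between V E u xs v"
  shows "path_between V E v (rev xs) u"
  using assms by (auto simp: path_between_def hd_rev last_rev insert_commute)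

lemma path_between_split:
  assumes "path_between V E u (xs @ x # ys) v"
  shows "path_between V E u (xs @ [x]) x" "path_between V E x (x # ys) v"
  using assms by (auto simp: path_between_def successively_append_iff hd_append split: if_splits)

lemma path_between_join:
  assumes "path_between V E u (xs @ [x]) x" "path_between V E x (x # ys) v"
    and "set xs \<inter> set ys = {}"
  shows "path_between V E u (xs @ x # ys) v"
  using assms by (auto simp: path_between_def successively_append_iff hd_append split: if_splits)

section \<open>Path sets in a tree\<close>

locale tree =
  fixes V :: "'a set" and E :: "'a set set"
  assumes tree: "finite_tree V E"
begin

abbreviation P :: "'a \<Rightarrow> 'a \<Rightarrow> 'a set" where
  "P \<equiv> path_verts V E"

lemma finite_V: "finite V" and V_ne: "V \<noteq> {}"
  using tree by (auto simp: finite_tree_def simple_graph_def connected_graph_def)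

lemma path_verts_eq:
  assumes "path_between V E u xs v"
  shows "P u v = set xs"
proof -
  have "u \<in> V" "v \<in> V"
    using assms by (auto simp: path_between_def)
  then have "(THE ys. path_between V E u ys v) = xs"
    using finite_tree_unique_path[OF tree] assms by (intro the1_equality) auto
  then show ?thesis
    by (simp add: path_verts_def)
qed

lemma obtain_path:
  assumes "u \<in> V" "v \<in> V"
  obtains xs where "path_between V E u xs v" "P u v = set xs"
  using finite_tree_unique_path[OF tree assms] path_verts_eq by blast

lemma ends_in_P:
  assumes "u \<in> V" "v \<in> V"
  shows "u \<in> P u v" "v \<in> P u v"
proof -
  obtain xs where "path_between V E u xs v" "P u v = set xs"
    using obtain_path[OF assms] .
  then show "u \<in> P u v" "v \<in> P u v"
    by (auto simp: path_between_def)
qed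

lemma P_subset:
  assumes "u \<in> V" "v \<in> V"
  shows "P u v \<subseteq> V"
proof -
  obtain xs where "path_between V E u xs v" "P u v = set xs"
    using obtain_path[OF assms] .
  then show ?thesis
    by (simp add: path_between_def)
qed

lemma P_commute:
  assumes "u \<in> V" "v \<in> V"
  shows "P u v = P v u"
proof -
  obtain xs where xs: "path_between V E u xs v" "P u v = set xs"
    using obtain_path[OF assms] .
  show ?thesis
    using path_verts_eq[OF path_between_rev[OF xs(1)]] xs(2) by simp
qed

lemma P_self: "u \<in> V \<Longrightarrow> P u u = {u}"
  using path_verts_eq[of u "[u]" u] by (simp add: path_between_def)

lemma P_split:
  assumes "u \<in> V" "v \<in> V" "x \<in> P u v"
  shows "P u v = P u x \<union> P x v" "P u x \<inter> P x v = {x}"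
proof -
  obtain xs where xs: "path_between V E u xs v" "P u v = set xs"
    using obtain_path assms by blast
  obtain ys zs where s: "xs = ys @ x # zs"
    using assms(3) xs(2) split_list by metis
  have "P u x = set (ys @ [x])" "P x v = set (x # zs)"
    using path_between_split[of V E u ys x zs v] xs(1) s path_verts_eq by metis+
  moreover have "distinct xs"
    using xs by (simp add: path_between_def)
  ultimately show "P u v = P u x \<union> P x v" "P u x \<inter> P x v = {x}"
    using xs s by auto
qed

text \<open>The median of three vertices is the first vertex on the path from \<open>w\<close> to \<open>v\<close> that lies
  on the path from \<open>u\<close> to \<open>v\<close>.\<close>

lemma median_exists:
  assumes "u \<in> V" "v \<in> V" "w \<in> V"
  obtains m where "m \<in> P u v" "m \<in> P w v" "m \<in> P w u"
proof -
  obtain xs where xs: "path_between V E w xs v" "P w v = set xs"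
    using obtain_path assms by blast
  obtain ys where ys: "path_between V E v ys u" "P u v = set ys"
    using obtain_path assms P_commute by metis
  have "v \<in> set xs" "v \<in> set ys"
    using xs ys assms ends_in_P by metis+
  then have "\<exists>x\<in>set xs. x \<in> set ys"
    by blast
  then obtain a m b where ab: "xs = a @ m # b" "m \<in> set ys" "\<forall>x\<in>set a. x \<notin> set ys"
    by (rule split_list_first_propE)
  obtain c d where cd: "ys = c @ m # d"
    using split_list[OF ab(2)] by blast
  \<comment> \<open>Since \<open>m\<close> is the first vertex of \<open>xs\<close> on
    \<open>ys\<close>, following \<open>xs\<close> up to \<open>m\<close> and then \<open>ys\<close>
    repeats no vertex. By uniqueness this is the path from \<open>w\<close> to
    \<open>u\<close>.\<close>
  have "path_between V E w (a @ m # d) u"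
  proof (rule path_between_join)
    show "path_between V E w (a @ [m]) m"
      using xs(1) unfolding ab(1) by (rule path_between_split)
    show "path_between V E m (m # d) u"
      using ys(1) unfolding cd by (rule path_between_split)
    show "set a \<inter> set d = {}"
      using ab(3) cd by auto
  qed
  then have "m \<in> P w u"
    by (simp add: path_verts_eq)
  then show ?thesis
    using that xs ys ab by simp
qed

text \<open>The median \<open>m\<close> of the three vertices cuts the path from \<open>u\<close> to
  \<open>w\<close> into two pieces, each an end piece of a path to \<open>v\<close>. The inclusion
  serves as a triangle inequality below.\<close>

lemma P_triangle:
  assumes "u \<in> V" "v \<in> V" "w \<in> V"
  shows "P u w \<subseteq> P u v \<union> P v w"
proof -
  obtain m where m: "m \<in> P w v" "m \<in> P u v" "m \<in> P u w"
    using median_exists[of w v u] assms by blast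
  then have "m \<in> V"
    using P_subset assms by blast
  have "P u w = P u m \<union> P m w" "P u m \<subseteq> P u v" "P m w \<subseteq> P v w"
    using P_split[of u w m] P_split[of u v m] P_split[of v w m] P_commute m assms \<open>m \<in> V\<close> by auto
  then show ?thesis by blast
qed

text \<open>A path starting at \<open>a\<close> orders its vertices linearly by distance from
  \<open>a\<close>. This compares two gates seen from the same root.\<close>

lemma P_linear:
  assumes "a \<in> V" "v \<in> V" "x \<in> P a v" "y \<in> P a v"
  shows "y \<in> P a x \<or> y \<in> P x v \<and> x \<in> P a y"
proof (cases "y \<in> P a x")
  case False
  then have y: "y \<in> P x v"
    using P_split[of a v x] assms by auto
  have V: "x \<in> V" "y \<in> V"
    using assms P_subset by blast+
  have "x \<in> P a y"
  proof (rule ccontr)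
    assume "x \<notin> P a y"
    then have "x \<in> P y v"
      using P_split[of a v y] assms by auto
    then have "x = y"
      using P_split(2)[of x v y] y V assms(2) ends_in_P(1)[of x y] by blast
    then show False
      using \<open>x \<notin> P a y\<close> ends_in_P(2)[of a y] V assms(1) by simp
  qed
  with y show ?thesis by blast
qed simp

text \<open>\<open>card (P a t)\<close> is one more than the distance from \<open>a\<close> to
  \<open>t\<close>, so it can replace distance in extremal choices; the equality case pins down the
  vertex on the path.\<close>

lemma card_P_mono:
  assumes "a \<in> V" "t \<in> V" "m \<in> P a t"
  shows "card (P a m) \<le> card (P a t)" "card (P a m) = card (P a t) \<Longrightarrow> m = t"
proof -
  have sub: "P a m \<subseteq> P a t"
    using P_split[of a t m] assms by blast
  have fin: "finite (P a t)" and "m \<in> V"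
    using P_subset[of a t] assms finite_V finite_subset by blast+
  show "card (P a m) \<le> card (P a t)"
    using sub fin by (rule card_mono[rotated])
  assume "card (P a m) = card (P a t)"
  then have "P a m = P a t"
    using sub fin card_subset_eq by blast
  then show "m = t"
    using P_split(2)[OF assms] ends_in_P(2)[of a t] ends_in_P(2)[of m t] assms(1,2) \<open>m \<in> V\<close>
    by auto
qed

section \<open>Convex vertex sets, gates and the Helly property\<close>

definition convex :: "'a set \<Rightarrow> bool" where
  "convex S \<longleftrightarrow> S \<subseteq> V \<and> (\<forall>x\<in>S. \<forall>y\<in>S. P x y \<subseteq> S)"

text \<open>The vertex \<open>t\<close> of \<open>S\<close> closest to \<open>a\<close>: every path from \<open>a\<close> into \<open>S\<close> enters through \<open>t\<close>.\<close>

lemma gate_exists: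
  assumes "convex S" "S \<noteq> {}" "a \<in> V"
  shows "\<exists>t\<in>S. \<forall>x\<in>S. t \<in> P a x"
proof -
  have S: "S \<subseteq> V"
    using assms by (simp add: convex_def)
  obtain t where t: "t \<in> S" "\<And>x. x \<in> S \<Longrightarrow> card (P a t) \<le> card (P a x)"
    using assms(2) ex_has_least_nat[of "\<lambda>t. t \<in> S" _ "\<lambda>t. card (P a t)"] by blast
  have "t \<in> P a x" if x: "x \<in> S" for x
  proof -
    \<comment> \<open>The median lies on \<open>P t x\<close>, hence in \<open>S\<close>, and on
      \<open>P a t\<close>, hence no farther from \<open>a\<close> than \<open>t\<close>; minimality
      makes it equal to \<open>t\<close>.\<close>
    obtain m where m: "m \<in> P t x" "m \<in> P a x" "m \<in> P a t"
      using median_exists[of t x a] t(1) x S assms(3) by blast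
    then have "m \<in> S"
      using assms(1) t(1) x unfolding convex_def by blast
    then have "m = t"
      using card_P_mono[of a t m] m t S assms by (meson in_mono le_antisym)
    with m show ?thesis by simp
  qed
  with t show ?thesis by blast
qed

text \<open>The common vertex is the gate, seen from a fixed root \<open>a\<close>, that is farthest from \<open>a\<close>.\<close>

lemma helly_subtrees:
  assumes "finite I" "I \<noteq> {}" "\<And>i. i \<in> I \<Longrightarrow> convex (T i)"
    and inter: "\<And>i j. i \<in> I \<Longrightarrow> j \<in> I \<Longrightarrow> T i \<inter> T j \<noteq> {}"
  shows "\<exists>r. \<forall>i\<in>I. r \<in> T i"
proof -
  obtain a where a: "a \<in> V"
    using V_ne by blast
  \<comment> \<open>Nonemptiness of \<open>T i\<close> is the case \<open>i = j\<close> of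
    \<open>inter\<close>.\<close>
  have "\<exists>t\<in>T i. \<forall>x\<in>T i. t \<in> P a x" if i: "i \<in> I" for i
    using gate_exists[OF assms(3)[OF i] _ a] inter[OF i i] by simp
  then have "\<forall>i\<in>I. \<exists>t. t \<in> T i \<and> (\<forall>x\<in>T i. t \<in> P a x)"
    by blast
  then obtain t where "\<forall>i\<in>I. t i \<in> T i \<and> (\<forall>x\<in>T i. t i \<in> P a x)"
    by (rule bchoice[THEN exE])
  then have t: "\<And>i. i \<in> I \<Longrightarrow> t i \<in> T i" "\<And>i x. i \<in> I \<Longrightarrow> x \<in> T i \<Longrightarrow> t i \<in> P a x"
    by blast+
  have TV: "T i \<subseteq> V" if "i \<in> I" for i
    using assms(3) that by (simp add: convex_def)
  obtain k where k: "k \<in> I" "\<And>i. i \<in> I \<Longrightarrow> card (P a (t i)) \<le> card (P a (t k))"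
  proof -
    let ?D = "(\<lambda>i. card (P a (t i))) ` I"
    have "Max ?D \<in> ?D"
      using assms(1,2) by (intro Max_in) auto
    then obtain k where "k \<in> I" "Max ?D = card (P a (t k))"
      by blast
    then show ?thesis
      using that[of k] Max_ge[of ?D] assms(1) by fastforce
  qed
  have "t k \<in> T i" if i: "i \<in> I" for i
  proof -
    obtain x where x: "x \<in> T i" "x \<in> T k"
      using inter[OF i k(1)] by blast
    have V: "x \<in> V" "t i \<in> V" "t k \<in> V"
      using x t(1) i k(1) TV[OF i] TV[OF k(1)] by blast+
    \<comment> \<open>Both gates lie on the path from \<open>a\<close> to the common vertex
      \<open>x\<close>. If \<open>t k\<close> comes no later than \<open>t i\<close>, maximality of
      its distance makes them equal; otherwise it lies between \<open>t i\<close> and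
      \<open>x\<close>, and convexity applies.\<close>
    consider "t k \<in> P a (t i)" | "t k \<in> P (t i) x"
      using P_linear[of a x "t i" "t k"] t(2)[OF i x(1)] t(2)[OF k(1) x(2)] a V by blast
    then show ?thesis
    proof cases
      case 1
      then have "t k = t i"
        using card_P_mono[of a "t i" "t k"] k i a V by (meson le_antisym)
      then show ?thesis
        using t i by simp
    next
      case 2
      then show ?thesis
        using assms(3)[OF i] t(1)[OF i] x by (auto simp: convex_def)
    qed
  qed
  then show ?thesis by blast
qed

text \<open>Paths are still taken in the whole tree. For convex \<open>S\<close> they stay inside
  \<open>S\<close>, so the recursion needs no induced subgraphs.\<close>

definition hub_labeling_on :: "'a set \<Rightarrow> ('a \<Rightarrow> 'a set) \<Rightarrow> bool" where
  "hub_labeling_on S H \<longleftrightarrow>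
     (\<forall>u\<in>S. H u \<subseteq> S) \<and> (\<forall>u\<in>S. \<forall>v\<in>S. H u \<inter> H v \<inter> P u v \<noteq> {})"

lemma central_vertex_exists:
  assumes S: "convex S" "S \<noteq> {}" and H: "hub_labeling_on S H"
  shows "\<exists>r\<in>S. \<forall>u\<in>S. \<exists>w\<in>H u. r \<in> P u w"
proof -
  define T where "T u = (\<Union>w\<in>H u. P u w)" for u
  have SV: "S \<subseteq> V" and HS: "\<And>u. u \<in> S \<Longrightarrow> H u \<subseteq> S"
    using S H by (auto simp: convex_def hub_labeling_on_def)
  have TS: "T u \<subseteq> S" if "u \<in> S" for u
    using that HS S unfolding T_def convex_def by blast
  \<comment> \<open>\<open>T u\<close> is star-shaped about \<open>u\<close>, and by
    \<open>P_triangle\<close> a path between two of its vertices stays within their paths to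
    \<open>u\<close>.\<close>
  have "convex (T u)" if u: "u \<in> S" for u
  proof -
    have "P u x \<subseteq> T u" if x: "x \<in> T u" for x
    proof -
      obtain w where "w \<in> H u" "x \<in> P u w"
        using x by (auto simp: T_def)
      then show ?thesis
        using P_split(1)[of u w x] u HS SV by (auto simp: T_def)
    qed
    moreover have "P x y \<subseteq> P u x \<union> P u y" if "x \<in> T u" "y \<in> T u" for x y
      using P_triangle[of x u y] P_commute[of x u] that TS u SV by blast
    ultimately show ?thesis
      using TS[OF u] SV unfolding convex_def by blast
  qed
  moreover have "T u \<inter> T v \<noteq> {}" if uv: "u \<in> S" "v \<in> S" for u v
  proof -
    obtain x where x: "x \<in> H u" "x \<in> H v"
      using H uv by (fastforce simp: hub_labeling_on_def)
    then have "x \<in> T u" "x \<in> T v"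
      using ends_in_P(2) HS uv SV by (fastforce simp: T_def)+
    then show ?thesis by blast
  qed
  ultimately obtain r where r: "\<And>u. u \<in> S \<Longrightarrow> r \<in> T u"
    using helly_subtrees[of S T] S finite_V SV finite_subset by blast
  moreover have "r \<in> S"
    using r TS S by blast
  ultimately show ?thesis
    by (auto simp: T_def)
qed

text \<open>The vertex set of the connected component of \<open>u\<close> in \<open>S - {r}\<close>.\<close>

definition component :: "'a set \<Rightarrow> 'a \<Rightarrow> 'a \<Rightarrow> 'a set" where
  "component S r u = {v \<in> S. r \<notin> P u v}"

lemma component_subset: "component S r u \<subseteq> S"
  by (auto simp: component_def)

section \<open>Components after deleting a vertex\<close>

context
  fixes S r
  assumes S: "convex S" and r: "r \<in> S"
begin

lemma S_sub: "S \<subseteq> V" and P_sub: "x \<in> S \<Longrightarrow> y \<in> S \<Longrightarrow> P x y \<subseteq> S"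
  using S unfolding convex_def by blast+

lemma component_self: "u \<in> S - {r} \<Longrightarrow> u \<in> component S r u"
  using S_sub P_self[of u] by (auto simp: component_def)

lemma center_notin_component: "u \<in> S \<Longrightarrow> r \<notin> component S r u"
  using S_sub r ends_in_P(2)[of u r] by (auto simp: component_def)

text \<open>As \<open>P u v\<close> avoids \<open>r\<close>, the triangle inclusion in both
  directions shows that \<open>r\<close> separates \<open>x\<close> from \<open>u\<close> exactly
  when it separates \<open>x\<close> from \<open>v\<close>.\<close>

lemma component_eq:
  assumes "u \<in> S" "v \<in> component S r u"
  shows "component S r v = component S r u"
proof -
  have "v \<in> S" "r \<notin> P u v" "r \<notin> P v u" "S \<subseteq> V"
    using assms S_sub P_commute[of u v] by (auto simp: component_def)
  then have "r \<in> P v x \<longleftrightarrow> r \<in> P u x" if "x \<in> S" for x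
    using P_triangle[of u v x] P_triangle[of v u x] assms(1) that by blast
  then show ?thesis
    by (auto simp: component_def)
qed

text \<open>After moving the base point to \<open>x\<close>, a vertex \<open>z\<close> of
  \<open>P x y\<close> stays in the component because \<open>P x z\<close> is part of
  \<open>P x y\<close>.\<close>

lemma convex_component:
  assumes "u \<in> S"
  shows "convex (component S r u)"
proof -
  have "P x y \<subseteq> component S r u" if xy: "x \<in> component S r u" "y \<in> component S r u" for x y
  proof
    fix z assume z: "z \<in> P x y"
    have V: "x \<in> S" "y \<in> S" "x \<in> V" "y \<in> V" "z \<in> S"
      using xy S_sub P_sub[of x y] z by (auto simp: component_def)
    have "y \<in> component S r x"
      using component_eq[OF assms xy(1)] xy by simp
    then have "r \<notin> P x z"
      using P_split(1)[of x y z] V z by (auto simp: component_def)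
    then have "z \<in> component S r x"
      using V by (simp add: component_def)
    then show "z \<in> component S r u"
      using component_eq[OF assms xy(1)] by simp
  qed
  then show ?thesis
    using S_sub component_subset[of S r u] unfolding convex_def by blast
qed

end

section \<open>Recursive construction of the hierarchy\<close>

lemma hub_labeling_on_convex_subset:
  assumes "hub_labeling_on S H" "convex C" "C \<subseteq> S"
  shows "hub_labeling_on C (\<lambda>u. H u \<inter> C)"
  unfolding hub_labeling_on_def
proof (intro conjI ballI)
  fix u v assume uv: "u \<in> C" "v \<in> C"
  with assms(3) have "u \<in> S" "v \<in> S"
    by blast+
  with uv have "H u \<inter> H v \<inter> P u v \<noteq> {}" "P u v \<subseteq> C"
    using assms(1,2) by (simp_all add: hub_labeling_on_def convex_def)
  then show "H u \<inter> C \<inter> (H v \<inter> C) \<inter> P u v \<noteq> {}"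
    by blast
qed auto

text \<open>Induction on \<open>card S\<close>: every component misses \<open>r\<close> and is
  therefore smaller. The bound is kept vertex by vertex, so one construction serves all values of
  \<open>p\<close>.\<close>

lemma hub_labeling_on_hierarchical:
  assumes "convex S" "hub_labeling_on S H"
  shows "\<exists>K. hub_labeling_on S K \<and> hierarchical S K \<and> (\<forall>u\<in>S. card (K u) \<le> card (H u))"
  using assms
proof (induction "card S" arbitrary: S H rule: less_induct)
  case less
  show ?case
  proof (cases "S = {}")
    case True
    then show ?thesis
      by (simp add: hub_labeling_on_def hierarchical_iff)
  next
    case False
    have SV: "S \<subseteq> V" and fin: "finite S" and HS: "\<And>u. u \<in> S \<Longrightarrow> H u \<subseteq> S"
      using less.prems finite_V by (auto simp: convex_def hub_labeling_on_def intro: finite_subset)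
    obtain r where r: "r \<in> S" "\<And>u. u \<in> S \<Longrightarrow> \<exists>w\<in>H u. r \<in> P u w"
      using central_vertex_exists less.prems False by blast
    note ctx = less.prems(1) r(1)
    let ?C = "component S r"
    have "\<exists>K. hub_labeling_on (?C u) K \<and> hierarchical (?C u) K \<and>
        (\<forall>v\<in>?C u. card (K v) \<le> card (H v \<inter> ?C u))" if "u \<in> S" for u
    proof (rule less.hyps)
      show "card (?C u) < card S"
        using center_notin_component[OF ctx that] component_subset r(1) fin
        by (metis psubsetI psubset_card_mono)
    qed (use convex_component[OF ctx that] component_subset hub_labeling_on_convex_subset less.prems in auto)
    \<comment> \<open>The choice is indexed by the component as a set, not by \<open>u\<close>, so
      that all vertices of one component share the same labeling. The component of \<open>r\<close>
      itself is empty.\<close>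
    then have "\<forall>C\<in>?C ` S. \<exists>K. hub_labeling_on C K \<and> hierarchical C K \<and>
        (\<forall>v\<in>C. card (K v) \<le> card (H v \<inter> C))"
      by blast
    then obtain G where "\<forall>C\<in>?C ` S. hub_labeling_on C (G C) \<and> hierarchical C (G C) \<and>
        (\<forall>v\<in>C. card (G C v) \<le> card (H v \<inter> C))"
      by (rule bchoice[THEN exE])
    then have G: "hub_labeling_on (?C u) (G (?C u))" "hierarchical (?C u) (G (?C u))"
        "\<And>v. v \<in> ?C u \<Longrightarrow> card (G (?C u) v) \<le> card (H v \<inter> ?C u)" if "u \<in> S" for u
      using that by auto
    \<comment> \<open>\<open>r\<close> becomes a hub of every vertex and has no hub but itself, so
      it is the least element of the order.\<close>
    define K where "K u = (if u = r then {r} else insert r (G (?C u) u))" for u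
    have self: "u \<in> ?C u" if "u \<in> S" "u \<noteq> r" for u
      using component_self[OF ctx] that by blast
    have G_sub: "G (?C u) u \<subseteq> ?C u" if "u \<in> S" "u \<noteq> r" for u
      using G(1) self that by (auto simp: hub_labeling_on_def)
    have r_K: "r \<in> K u" for u
      by (simp add: K_def)
    \<comment> \<open>Apart from \<open>r\<close>, hubs stay in the component of their vertex, so
      antisymmetry and transitivity reduce to those of a single \<open>G (?C v)\<close>.\<close>
    have K_below: "u \<noteq> r \<and> v \<noteq> r \<and> ?C u = ?C v \<and> u \<in> ?C v \<and> u \<in> G (?C v) v"
      if "u \<in> K v" "u \<noteq> r" "v \<in> S" for u v
      using that G_sub[of v] component_eq[OF ctx, of v u] by (auto simp: K_def split: if_splits)
    have "hub_labeling_on S K"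
      unfolding hub_labeling_on_def
    proof (intro conjI ballI)
      fix u assume "u \<in> S"
      then show "K u \<subseteq> S"
        using G_sub[of u] component_subset[of S r u] r(1) by (auto simp: K_def)
    next
      fix u v assume uv: "u \<in> S" "v \<in> S"
      show "K u \<inter> K v \<inter> P u v \<noteq> {}"
      proof (cases "r \<in> P u v")
        case True
        then show ?thesis
          using r_K by blast
      next
        case False
        \<comment> \<open>A path avoiding \<open>r\<close> has both ends in one component, whose
          labeling supplies the common hub.\<close>
        then have "u \<noteq> r" "v \<noteq> r" "v \<in> ?C u"
          using ends_in_P[of u v] uv SV by (auto simp: component_def)
        moreover from this have "?C v = ?C u"
          using component_eq[OF ctx] uv by blast
        ultimately show ?thesis
          using G(1)[OF uv(1)] self[OF uv(1)] unfolding hub_labeling_on_def K_def by auto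
      qed
    qed
    moreover have "hierarchical S K"
      unfolding hierarchical_iff
    proof (intro conjI ballI impI)
      fix u assume u: "u \<in> S"
      then show "u \<in> K u"
        using G(2)[OF u] self[OF u] by (auto simp: K_def hierarchical_iff)
    next
      fix u v assume *: "u \<in> S" "v \<in> S" "u \<in> K v" "v \<in> K u"
      show "u = v"
      proof (cases "u = r \<or> v = r")
        case True
        then show ?thesis
          using * by (auto simp: K_def)
      next
        case False
        then show ?thesis
          using K_below[of u v] K_below[of v u] * G(2)[of v] unfolding hierarchical_iff by metis
      qed
    next
      fix u v w assume *: "u \<in> S" "v \<in> S" "w \<in> S" "u \<in> K v" "v \<in> K w"
      show "u \<in> K w"
      proof (cases "u = r")
        case True
        then show ?thesis
          using r_K by simp
      next
        case False
        then have uv: "v \<noteq> r" "?C u = ?C v" "u \<in> ?C v" "u \<in> G (?C v) v"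
          using K_below[of u v] * by auto
        then have vw: "w \<noteq> r" "?C v = ?C w" "v \<in> ?C w" "v \<in> G (?C w) w"
          using K_below[of v w] * by auto
        have "u \<in> G (?C w) w"
          using G(2)[of w] uv vw self[of w] *(3) unfolding hierarchical_iff by metis
        then show ?thesis
          using vw by (simp add: K_def)
      qed
    qed
    moreover have "card (K u) \<le> card (H u)" if u: "u \<in> S" for u
    proof -
      have finH: "finite (H u)"
        using HS[OF u] fin finite_subset by blast
      obtain w where w: "w \<in> H u" "r \<in> P u w"
        using r(2) u by blast
      show ?thesis
      proof (cases "u = r")
        case True
        have "0 < card (H u)"
          using w finH by (auto simp: card_gt_0_iff)
        then show ?thesis
          using True by (simp add: K_def)
      next
        case False
        have "w \<notin> ?C u"
          using w by (simp add: component_def)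
        \<comment> \<open>The hub \<open>w\<close> lost in the restriction pays for the inserted
          \<open>r\<close>.\<close>
        then have "card (H u \<inter> ?C u) < card (H u)"
          using w finH by (intro psubset_card_mono) auto
        moreover have "card (insert r (G (?C u) u)) \<le> Suc (card (G (?C u) u))"
          by (rule card_insert_le_m1) auto
        ultimately show ?thesis
          using G(3)[OF u self[OF u False]] False by (simp add: K_def)
      qed
    qed
    ultimately show ?thesis by blast
  qed
qed

section \<open>Optimal labelings of the whole tree\<close>

lemma hub_labeling_hierarchical:
  assumes "hub_labeling V E H"
  shows "\<exists>K. hub_labeling V E K \<and> hierarchical V K \<and> (\<forall>u\<in>V. card (K u) \<le> card (H u))"
  using hub_labeling_on_hierarchical[of V H] assms P_subset
  by (auto simp: hub_labeling_on_def hub_labeling_def convex_def)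

lemma optimal_hub_labeling_exists: "\<exists>H. optimal_hub_labeling V E p H"
proof -
  let ?L = "{H. hub_labeling V E H}"
  \<comment> \<open>Labelings are functions on the whole type, possibly infinitely many, but the
    cost sees only their restrictions to \<open>V\<close>. Hence only finitely many costs occur and
    a minimum is attained.\<close>
  have "lp_cost V p ` ?L \<subseteq> lp_cost V p ` (V \<rightarrow>\<^sub>E Pow V)"
  proof (rule image_subsetI)
    fix H assume "H \<in> ?L"
    then have "restrict H V \<in> V \<rightarrow>\<^sub>E Pow V"
      by (auto simp: hub_labeling_def)
    moreover have "lp_cost V p H = lp_cost V p (restrict H V)"
      by (rule lp_cost_cong) simp
    ultimately show "lp_cost V p H \<in> lp_cost V p ` (V \<rightarrow>\<^sub>E Pow V)"
      by blast
  qed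
  then have fin: "finite (lp_cost V p ` ?L)"
    by (rule finite_subset) (simp add: finite_PiE finite_V)
  have "hub_labeling V E (\<lambda>_. V)"
    using ends_in_P(1) by (fastforce simp: hub_labeling_def)
  then have "Min (lp_cost V p ` ?L) \<in> lp_cost V p ` ?L"
    using fin by (intro Min_in) auto
  then obtain H where "hub_labeling V E H" "lp_cost V p H = Min (lp_cost V p ` ?L)"
    by auto
  then show ?thesis
    using fin unfolding optimal_hub_labeling_def by (metis Min_le imageI mem_Collect_eq)
qed

end

theorem mainTheorem1:
  fixes V :: "'a set" and E :: "'a set set" and p :: ereal
  assumes "finite_tree V E"
    and "1 \<le> p"
  shows "\<exists>H. optimal_hub_labeling V E p H \<and> hierarchical V H"
proof -
  interpret tree V E
    by unfold_locales (rule assms(1))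
  obtain H where H: "optimal_hub_labeling V E p H"
    using optimal_hub_labeling_exists by blast
  then have "hub_labeling V E H"
    by (simp add: optimal_hub_labeling_def)
  then obtain K where K: "hub_labeling V E K" "hierarchical V K" "\<forall>u\<in>V. card (K u) \<le> card (H u)"
    using hub_labeling_hierarchical by blast
  then have "lp_cost V p K \<le> lp_cost V p H"
    using lp_cost_mono finite_V V_ne assms(2) by blast
  then show ?thesis
    using H K unfolding optimal_hub_labeling_def by (meson order_trans)
qed

end
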